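(* Let $\lambda,\mu,\nu>0$, let $K$ be a positive integer and let $0<M\le K$. For each $n\ge 1$ let $U_n(\infty)$ be the stationary number of uncharged EVs in the charging-station Markov process (defined in the context) with arrival rate $n\lambda$, power capacity $nM$, $nK$ parking spaces, parking rate $\mu$ and charging rate $\nu$. Let $E_\mu$ and $E_\nu$ be independent exponential random variables with rates $\mu$ and $\nu$. Then $$\frac{U_n(\infty)}{n}\to u^*\qquad\text{as } n\to\infty$$ (in distribution, equivalently in probability, since the limit is a constant), where $u^*$ is the unique positive solution of the fixed-point equation $$u^*=\min\{\lambda,\mu K\}\;\mathbb{E}\Big[\min\Big\{E_\mu,\;E_\nu\max\Big\{1,\frac{u^*}{M}\Big\}\Big\}\Big].$$
   Context: Model with arrival rate $\lambda'$, $K'$ parking spaces and power capacity $M'$: a charging station has $K'$ parking spaces, each with an EV charger. Electric vehicles (EVs) arrive according to a Poisson process of rate $\lambda'$; each EV has an exponential parking time with rate $\mu$ and an exponential charging requirement with rate $\nu$; interarrival times, parking times and charging requirements are mutually independent. An EV leaves when its parking time expires, whether or not it is fully charged; a fully charged EV stays until its parking time expires. An EV that arrives when all spaces are occupied leaves immediately (is lost). $Q(t)$ is the total number of EVs present at time $t$, and $U(t)$ is the number of EVs present that are not fully charged. The power consumed when there are $u$ uncharged EVs is $\min\{u,M'\}$, and it is shared equally among the uncharged EVs. Thus $(U(t),Q(t))$ is a continuous-time Markov chain on $\{(u,q)\in\mathbb{Z}^2: 0\le u\le q\le K'\}$ with transition rates: - $(u,q)\to(u+1,q+1)$ at rate $\lambda'$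 if $q<K'$; - $(u,q)\to(u-1,q)$ at rate $\nu\min\{u,M'\}$; - $(u,q)\to(u-1,q-1)$ at rate $\mu u$; - $(u,q)\to(u,q-1)$ at rate $\mu(q-u)$. The argument $(\infty)$ denotes a random variable with the stationary distribution of the chain. In the $n$-th system, $\lambda'=n\lambda$, $K'=nK$, $M'=nM$. *)

theory Defs
  imports "HOL-Probability.Probability"
begin

section \<open>Continuous-time Markov chains on a finite state space\<close>

text \<open>
  A chain is given by a finite state space \<open>S\<close> and its transition rates: \<open>r x y\<close> is the rate of
  the transition from \<open>x\<close> to \<open>y\<close>, for \<open>x \<noteq> y\<close> in \<open>S\<close>. Values of \<open>r\<close> on the diagonal or
  outside \<open>S\<close> are ignored.
\<close>

definition ctmc_generator :: "'s set \<Rightarrow> ('s \<Rightarrow> 's \<Rightarrow> real) \<Rightarrow> 's \<Rightarrow> 's \<Rightarrow> real" where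
  "ctmc_generator S r x y = (if x = y then - (\<Sum>z\<in>S - {x}. r x z) else r x y)"

fun ctmc_generator_power :: "'s set \<Rightarrow> ('s \<Rightarrow> 's \<Rightarrow> real) \<Rightarrow> nat \<Rightarrow> 's \<Rightarrow> 's \<Rightarrow> real" where
  "ctmc_generator_power S r 0 x y = of_bool (x = y)"
| "ctmc_generator_power S r (Suc k) x y =
     (\<Sum>z\<in>S. ctmc_generator S r x z * ctmc_generator_power S r k z y)"

text \<open>
  The probability of being in \<open>y\<close> at time \<open>t\<close> when started in \<open>x\<close>: the \<open>(x, y)\<close> entry of
  the matrix exponential of \<open>t\<close> times the generator.
\<close>

definition ctmc_transition :: "'s set \<Rightarrow> ('s \<Rightarrow> 's \<Rightarrow> real) \<Rightarrow> real \<Rightarrow> 's \<Rightarrow> 's \<Rightarrow> real" where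
  "ctmc_transition S r t x y = (\<Sum>k. ctmc_generator_power S r k x y * t ^ k / fact k)"

definition ctmc_stationary :: "'s set \<Rightarrow> ('s \<Rightarrow> 's \<Rightarrow> real) \<Rightarrow> 's pmf \<Rightarrow> bool" where
  "ctmc_stationary S r p \<longleftrightarrow> set_pmf p \<subseteq> S \<and>
     (\<forall>t\<ge>0. \<forall>y\<in>S. (\<Sum>x\<in>S. pmf p x * ctmc_transition S r t x y) = pmf p y)"

lemma ctmc_generator_power_bound:
  assumes "finite S" "x \<in> S"
  shows "\<bar>ctmc_generator_power S r k x y\<bar> \<le> (\<Sum>x\<in>S. \<Sum>z\<in>S. \<bar>ctmc_generator S r x z\<bar>) ^ k"
  using assms(2)
proof (induction k arbitrary: x)
  case 0
  then show ?case by simp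
next
  case (Suc k)
  let ?C = "\<Sum>x\<in>S. \<Sum>z\<in>S. \<bar>ctmc_generator S r x z\<bar>"
  have C0: "0 \<le> ?C" by (intro sum_nonneg) auto
  have "\<bar>ctmc_generator_power S r (Suc k) x y\<bar>
      \<le> (\<Sum>z\<in>S. \<bar>ctmc_generator S r x z * ctmc_generator_power S r k z y\<bar>)"
    by simp
  also have "\<dots> \<le> (\<Sum>z\<in>S. \<bar>ctmc_generator S r x z\<bar> * ?C ^ k)"
    by (intro sum_mono) (simp add: abs_mult mult_left_mono Suc.IH)
  also have "\<dots> = (\<Sum>z\<in>S. \<bar>ctmc_generator S r x z\<bar>) * ?C ^ k"
    by (simp add: sum_distrib_right)
  also have "\<dots> \<le> ?C * ?C ^ k"
    using Suc.prems assms(1) C0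
    by (intro mult_right_mono member_le_sum sum_nonneg zero_le_power) auto
  finally show ?case by simp
qed

lemma summable_ctmc_transition:
  assumes "finite S" "x \<in> S"
  shows "summable (\<lambda>k. ctmc_generator_power S r k x y * t ^ k / fact k)"
proof (rule summable_comparison_test')
  let ?C = "\<Sum>x\<in>S. \<Sum>z\<in>S. \<bar>ctmc_generator S r x z\<bar>"
  show "summable (\<lambda>k. inverse (fact k) * (?C * \<bar>t\<bar>) ^ k)"
    by (rule summable_exp)
  show "norm (ctmc_generator_power S r k x y * t ^ k / fact k) \<le> inverse (fact k) * (?C * \<bar>t\<bar>) ^ k"
    if "0 \<le> k" for k
    using ctmc_generator_power_bound[OF assms, of r k y]
    by (simp add: abs_mult power_abs power_mult_distrib divide_simps mult_right_mono)
qed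

text \<open>Stationarity is equivalent to global balance.\<close>

lemma ctmc_stationary_iff_balance:
  assumes "finite S"
  shows "ctmc_stationary S r p \<longleftrightarrow> set_pmf p \<subseteq> S \<and>
     (\<forall>y\<in>S. (\<Sum>x\<in>S. pmf p x * ctmc_generator S r x y) = 0)"
proof -
  define v where "v k y = (\<Sum>x\<in>S. pmf p x * ctmc_generator_power S r k x y)" for k y
  have v0: "v 0 y = pmf p y" if "y \<in> S" for y
    using assms that by (simp add: v_def)
  have vSuc: "v (Suc k) y =
      (\<Sum>z\<in>S. (\<Sum>x\<in>S. pmf p x * ctmc_generator S r x z) * ctmc_generator_power S r k z y)" for k y
    unfolding v_def ctmc_generator_power.simps sum_distrib_left sum_distrib_right
    by (subst sum.swap) (simp add: mult_ac)
  have v1: "v (Suc 0) y = (\<Sum>x\<in>S. pmf p x * ctmc_generator S r x y)" if "y \<in> S" for y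
    using assms that by (simp add: vSuc)
  have sms: "(\<lambda>k. v k y / fact k * t ^ k) sums (\<Sum>x\<in>S. pmf p x * ctmc_transition S r t x y)" for t y
  proof -
    have "(\<lambda>k. \<Sum>x\<in>S. pmf p x * (ctmc_generator_power S r k x y * t ^ k / fact k))
        sums (\<Sum>x\<in>S. pmf p x * ctmc_transition S r t x y)"
      unfolding ctmc_transition_def
      by (intro sums_sum sums_mult summable_sums summable_ctmc_transition assms)
    then show ?thesis
      by (simp add: v_def sum_distrib_left sum_divide_distrib mult_ac)
  qed
  show ?thesis
  proof (intro iffI conjI ballI)
    assume st: "ctmc_stationary S r p"
    then show "set_pmf p \<subseteq> S" by (simp add: ctmc_stationary_def)
    fix y assume y: "y \<in> S"
    define h where "h t = (\<Sum>k. v k y / fact k * t ^ k)" for t :: real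
    have "summable (\<lambda>k. v k y / fact k * 1 ^ k)"
      using sms by (rule sums_summable)
    then have "(h has_field_derivative (\<Sum>k. diffs (\<lambda>k. v k y / fact k) k * 0 ^ k)) (at 0)"
      unfolding h_def by (rule termdiffs_strong) simp
    moreover have "(\<Sum>k. diffs (\<lambda>k. v k y / fact k) k * (0::real) ^ k) = v (Suc 0) y"
      by (subst powser_zero) (simp add: diffs_def)
    ultimately have "(h has_field_derivative v (Suc 0) y) (at 0 within {0..})"
      by (simp only: has_field_derivative_at_within)
    moreover have "(h has_field_derivative 0) (at 0 within {0..})"
    proof (rule has_field_derivative_transform_within[where d = 1])
      show "((\<lambda>_. pmf p y) has_field_derivative 0) (at 0 within {0..})"
        by simp
      fix t :: real assume "t \<in> {0..}"
      then show "pmf p y = h t"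
        using st y sums_unique[OF sms[of y t]] by (simp add: h_def ctmc_stationary_def)
    qed simp_all
    moreover have "at (0::real) within {0..} \<noteq> bot"
      by (simp add: at_within_Ici_at_right trivial_limit_at_right_real)
    ultimately have "v (Suc 0) y = 0"
      by (simp add: has_field_derivative_iff tendsto_unique)
    then show "(\<Sum>x\<in>S. pmf p x * ctmc_generator S r x y) = 0"
      using v1 y by simp
  next
    assume bal: "set_pmf p \<subseteq> S \<and> (\<forall>y\<in>S. (\<Sum>x\<in>S. pmf p x * ctmc_generator S r x y) = 0)"
    have "(\<Sum>x\<in>S. pmf p x * ctmc_transition S r t x y) = pmf p y" if "y \<in> S" for t y
    proof -
      have "v k y = 0" if "k \<noteq> 0" for k
        using that bal by (cases k) (simp_all add: vSuc)
      then have "(\<lambda>k. v k y / fact k * t ^ k) sums (\<Sum>k\<in>{0}. v k y / fact k * t ^ k)"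
        by (intro sums_finite) auto
      from sums_unique2[OF sms this] show ?thesis
        using v0 that by simp
    qed
    then show "ctmc_stationary S r p"
      using bal by (simp add: ctmc_stationary_def)
  qed
qed

section \<open>The charging station\<close>

text \<open>
  A state is a pair \<open>(u, q)\<close> with \<open>q\<close> the number of EVs present and \<open>u\<close> the number of those that
  are not fully charged. The capacity \<open>M\<close> is real, since \<open>n * M\<close> need not be an integer.
\<close>

definition ev_states :: "nat \<Rightarrow> (nat \<times> nat) set" where
  "ev_states K = {(u, q). u \<le> q \<and> q \<le> K}"

text \<open>
  Transitions to \<open>u - 1\<close> or \<open>q - 1\<close> are written as \<open>u' + 1 = u\<close> or \<open>q' + 1 = q\<close> because of truncated
  subtraction. Blocking of arrivals when \<open>q = K\<close> is the condition \<open>q < K\<close>.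
\<close>

definition ev_rate ::
  "real \<Rightarrow> real \<Rightarrow> real \<Rightarrow> nat \<Rightarrow> real \<Rightarrow> nat \<times> nat \<Rightarrow> nat \<times> nat \<Rightarrow> real" where
  "ev_rate lam \<mu> \<nu> K M = (\<lambda>(u, q) (u', q').
     if u' = u + 1 \<and> q' = q + 1 \<and> q < K then lam
     else if u' + 1 = u \<and> q' = q then \<nu> * min (real u) M
     else if u' + 1 = u \<and> q' + 1 = q then \<mu> * real u
     else if u' = u \<and> q' + 1 = q then \<mu> * (real q - real u)
     else 0)"

end

theory Submission
  imports Defs "HOL-Real_Asymp.Real_Asymp"
begin

text \<open>
  Write \<open>x = U / n\<close>, \<open>y = Q / n\<close>, let \<open>a\<close> be \<open>lam\<close> when \<open>y < K\<close> and \<open>0\<close> when the station is full, and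
  put \<open>b = min K (lam / \<mu>)\<close>, the fluid level of \<open>y\<close>. To leading order \<open>x\<close> has drift
  \<open>a - \<mu> * x - \<nu> * min x M\<close> and \<open>y\<close> has drift \<open>a - \<mu> * y\<close>. The fluid equilibrium \<open>s\<close> is the root of
  \<open>\<mu> * s + \<nu> * min s M = \<mu> * b\<close>; since \<open>min E\<mu> (c * E\<nu>)\<close> is exponential with rate \<open>\<mu> + \<nu> / c\<close> and
  \<open>u / max 1 (u / M) = min u M\<close>, this is the fixed-point equation. Its left side is strictly
  increasing in \<open>s\<close>, hence the root is unique.

  In stationarity the generator applied to any function of the state has expectation zero
  (\<open>expectation_scaled_drift_eq_0\<close>), and two well-chosen functions give the convergence.

  The function \<open>(y - b)\<^sup>2 / 2\<close> is a Lyapunov function for the occupancy, and it shows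
  \<open>E (y - b)\<^sup>2 = O(1 / n)\<close> (\<open>scaled_drift_occupancy_le\<close>).

  For \<open>x\<close> the obvious choice \<open>(x - s)\<^sup>2 / 2\<close> leaves the expectation of \<open>(x - s) * (a - \<mu> * b)\<close>, in which \<open>a\<close>
  does not converge when \<open>lam > \<mu> * K\<close>: blocking switches between on and off on a fast time scale.
  The switching averages out because \<open>y\<close> is nearly constant: the drift of \<open>x * (y - b)\<close> is
  \<open>x * (a - \<mu> * b)\<close> up to terms of order \<open>\<bar>y - b\<bar> + 1 / n\<close>, and that of \<open>y\<close> is \<open>a - \<mu> * b\<close> up to such terms.
  Adding \<open>x * (y - b) - s * y\<close> to \<open>- (x - s)\<^sup>2 / 2\<close> therefore removes \<open>a\<close> up to such terms, and what
  remains is at least \<open>\<mu> * (x - s)\<^sup>2\<close> by monotonicity of \<open>min\<close> (\<open>scaled_drift_uncharged_ge\<close>). Taking expectations gives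
  \<open>E (x - s)\<^sup>2 = O(1 / sqrt n)\<close> (\<open>uncharged_second_moment_bound\<close>), and Chebyshev's inequality gives
  convergence in probability, hence in distribution.
\<close>

section \<open>Stationary expectations of generators\<close>

text \<open>
  Global balance integrated against \<open>f\<close>. Rows of the generator sum to zero, so its diagonal is absorbed
  by the differences \<open>f y - f x\<close>.
\<close>

lemma ctmc_stationary_expectation_generator_eq_0:
  fixes f :: "'s \<Rightarrow> real"
  assumes fin: "finite S" and stat: "ctmc_stationary S r p"
  shows "measure_pmf.expectation p (\<lambda>x. \<Sum>y\<in>S. r x y * (f y - f x)) = 0"
proof -
  have supp: "set_pmf p \<subseteq> S"
    and bal: "\<And>y. y \<in> S \<Longrightarrow> (\<Sum>x\<in>S. pmf p x * ctmc_generator S r x y) = 0"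
    using stat unfolding ctmc_stationary_iff_balance[OF fin] by auto
  have row: "(\<Sum>y\<in>S. ctmc_generator S r x y * f y) = (\<Sum>y\<in>S. r x y * (f y - f x))"
    if x: "x \<in> S" for x
  proof -
    have "(\<Sum>y\<in>S. ctmc_generator S r x y * f y)
        = - (\<Sum>z\<in>S - {x}. r x z) * f x + (\<Sum>y\<in>S - {x}. ctmc_generator S r x y * f y)"
      by (simp add: sum.remove[OF fin x] ctmc_generator_def)
    also have "(\<Sum>y\<in>S - {x}. ctmc_generator S r x y * f y) = (\<Sum>y\<in>S - {x}. r x y * f y)"
      by (rule sum.cong) (auto simp: ctmc_generator_def)
    also have "- (\<Sum>z\<in>S - {x}. r x z) * f x + (\<Sum>y\<in>S - {x}. r x y * f y)
        = (\<Sum>y\<in>S - {x}. r x y * (f y - f x))"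
      by (simp add: right_diff_distrib sum_subtractf sum_distrib_right)
    also have "\<dots> = (\<Sum>y\<in>S. r x y * (f y - f x))"
      by (simp add: sum.remove[OF fin x])
    finally show ?thesis .
  qed
  have "measure_pmf.expectation p (\<lambda>x. \<Sum>y\<in>S. r x y * (f y - f x))
      = (\<Sum>x\<in>S. pmf p x * (\<Sum>y\<in>S. ctmc_generator S r x y * f y))"
    using supp fin by (subst integral_measure_pmf[of S]) (auto simp: row)
  also have "\<dots> = (\<Sum>y\<in>S. (\<Sum>x\<in>S. pmf p x * ctmc_generator S r x y) * f y)"
    unfolding sum_distrib_left sum_distrib_right by (subst sum.swap) (simp add: mult_ac)
  also have "\<dots> = 0"
    using bal by simp
  finally show ?thesis .
qed

lemma finite_ev_states: "finite (ev_states K)"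
  by (rule finite_subset[of _ "{..K} \<times> {..K}"]) (auto simp: ev_states_def)

text \<open>
  A target that truncated subtraction or the constraint \<open>u \<le> q\<close> would spoil, such as \<open>u - 1\<close> at \<open>u = 0\<close> or
  \<open>(u, q - 1)\<close> at \<open>u = q\<close>, has rate zero, so the formula holds on the boundary as well.
\<close>

lemma ev_generator_apply:
  assumes "(u, q) \<in> ev_states K" "0 \<le> M"
  shows "(\<Sum>z\<in>ev_states K. ev_rate lam \<mu> \<nu> K M (u, q) z * (f z - f (u, q))) =
    (if q < K then lam * (f (u + 1, q + 1) - f (u, q)) else 0)
    + \<nu> * min (real u) M * (f (u - 1, q) - f (u, q))
    + \<mu> * real u * (f (u - 1, q - 1) - f (u, q))
    + \<mu> * (real q - real u) * (f (u, q - 1) - f (u, q))"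
proof -
  have uq: "u \<le> q" "q \<le> K"
    using assms by (auto simp: ev_states_def)
  let ?t = "\<lambda>c v z. if z = v then c * (f z - f (u, q)) else 0"
  have rate: "ev_rate lam \<mu> \<nu> K M (u, q) (a, b) =
      (if (a, b) = (u + 1, q + 1) then of_bool (q < K) * lam else 0)
      + (if (a, b) = (u - 1, q) then \<nu> * min (real u) M else 0)
      + (if (a, b) = (u - 1, q - 1) then \<mu> * real u else 0)
      + (if (a, b) = (u, q - 1) then \<mu> * (real q - real u) else 0)" for a b
    using uq assms(2) by (cases u; cases q) (auto simp: ev_rate_def)
  have delta: "(\<Sum>z\<in>ev_states K. ?t c v z) = c * (f v - f (u, q))"
    if "c = 0 \<or> v \<in> ev_states K" for c v
    using that by (auto simp: sum.delta[OF finite_ev_states])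
  have "(\<Sum>z\<in>ev_states K. ev_rate lam \<mu> \<nu> K M (u, q) z * (f z - f (u, q))) =
    (\<Sum>z\<in>ev_states K. ?t (of_bool (q < K) * lam) (u + 1, q + 1) z
      + ?t (\<nu> * min (real u) M) (u - 1, q) z
      + ?t (\<mu> * real u) (u - 1, q - 1) z
      + ?t (\<mu> * (real q - real u)) (u, q - 1) z)"
  proof (rule sum.cong[OF refl])
    fix z assume "z \<in> ev_states K"
    obtain a b where z: "z = (a, b)"
      by (cases z)
    have push: "(if P then c else 0) * d = (if P then c * d else 0)" for P and c d :: real
      by simp
    show "ev_rate lam \<mu> \<nu> K M (u, q) z * (f z - f (u, q)) =
        ?t (of_bool (q < K) * lam) (u + 1, q + 1) z + ?t (\<nu> * min (real u) M) (u - 1, q) z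
        + ?t (\<mu> * real u) (u - 1, q - 1) z + ?t (\<mu> * (real q - real u)) (u, q - 1) z"
      unfolding z rate distrib_right push ..
  qed
  also have "\<dots> = of_bool (q < K) * lam * (f (u + 1, q + 1) - f (u, q))
      + \<nu> * min (real u) M * (f (u - 1, q) - f (u, q))
      + \<mu> * real u * (f (u - 1, q - 1) - f (u, q))
      + \<mu> * (real q - real u) * (f (u, q - 1) - f (u, q))"
  proof -
    have "of_bool (q < K) * lam = 0 \<or> (u + 1, q + 1) \<in> ev_states K"
      "\<nu> * min (real u) M = 0 \<or> (u - 1, q) \<in> ev_states K"
      "\<mu> * real u = 0 \<or> (u - 1, q - 1) \<in> ev_states K"
      "\<mu> * (real q - real u) = 0 \<or> (u, q - 1) \<in> ev_states K"
      using uq by (auto simp: ev_states_def)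
    then show ?thesis
      unfolding sum.distrib by (simp only: delta)
  qed
  finally show ?thesis
    by (cases "q < K") simp_all
qed

text \<open>
  The generator of \<open>(U / n, Q / n)\<close> with \<open>N = n\<close>, as an operator on functions of two real variables,
  so that drift estimates become real algebra. All rates are \<open>N\<close> times a function of the scaled state.
\<close>

definition scaled_drift ::
  "real \<Rightarrow> real \<Rightarrow> real \<Rightarrow> real \<Rightarrow> real \<Rightarrow> real \<Rightarrow> (real \<Rightarrow> real \<Rightarrow> real) \<Rightarrow> real \<Rightarrow> real \<Rightarrow> real" where
  "scaled_drift lam \<mu> \<nu> K M N g x y = N *
     ((if y < K then lam * (g (x + 1 / N) (y + 1 / N) - g x y) else 0)
      + \<nu> * min x M * (g (x - 1 / N) y - g x y)
      + \<mu> * x * (g (x - 1 / N) (y - 1 / N) - g x y)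
      + \<mu> * (y - x) * (g x (y - 1 / N) - g x y))"

lemma expectation_scaled_drift_eq_0:
  assumes n: "n \<ge> 1" and M: "0 \<le> M"
    and stat: "ctmc_stationary (ev_states (n * K))
      (ev_rate (real n * lam) \<mu> \<nu> (n * K) (real n * M)) p"
  shows "measure_pmf.expectation p
    (\<lambda>(u, q). scaled_drift lam \<mu> \<nu> K M n g (real u / n) (real q / n)) = 0"
proof -
  let ?S = "ev_states (n * K)" and ?r = "ev_rate (real n * lam) \<mu> \<nu> (n * K) (real n * M)"
  define f where "f = (\<lambda>(u, q). g (real u / real n) (real q / real n))"
  have supp: "set_pmf p \<subseteq> ?S"
    using stat by (simp add: ctmc_stationary_def)
  have drift: "scaled_drift lam \<mu> \<nu> K M n g (real u / n) (real q / n)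
      = (\<Sum>z\<in>?S. ?r (u, q) z * (f z - f (u, q)))" if uq: "(u, q) \<in> ?S" for u q
  proof -
    have full: "real q / real n < real K \<longleftrightarrow> q < n * K"
      using n by (simp add: divide_less_eq mult.commute flip: of_nat_mult)
    have power: "real n * min (real u / real n) M = min (real u) (real n * M)"
      using n by (simp add: min_mult_distrib_left)
    have scale: "real n * (\<mu> * (real k / real n) * v) = \<mu> * real k * v"
      "real n * (\<mu> * (real q / real n - real u / real n) * v) = \<mu> * (real q - real u) * v" for k v
      using n by (simp_all add: field_simps)
    have le: "u \<le> q"
      using uq by (simp add: ev_states_def)
    have pred: "a * (g ((real u - 1) / n) v - w) = a * (g (real (u - 1) / n) v - w)"
      if "u = 0 \<Longrightarrow> a = 0" for a v w
      using that by (cases u) simp_all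
    have pred': "a * (g v ((real q - 1) / n) - w) = a * (g v (real (q - 1) / n) - w)"
      if "q = 0 \<Longrightarrow> a = 0" for a v w
      using that by (cases q) simp_all
    have preds:
      "\<nu> * min (real u) (real n * M) * (g ((real u - 1) / n) v - w)
        = \<nu> * min (real u) (real n * M) * (g (real (u - 1) / n) v - w)"
      "\<mu> * real u * (g ((real u - 1) / n) ((real q - 1) / n) - w)
        = \<mu> * real u * (g (real (u - 1) / n) (real (q - 1) / n) - w)"
      "\<mu> * (real q - real u) * (g v ((real q - 1) / n) - w)
        = \<mu> * (real q - real u) * (g v (real (q - 1) / n) - w)" for v w
      subgoal using M by (intro pred) simp
      subgoal using le by (subst pred, simp, intro pred') simp
      subgoal using le by (intro pred') simp
      done
    have nM: "0 \<le> real n * M"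
      using M by simp
    have "scaled_drift lam \<mu> \<nu> K M n g (real u / n) (real q / n) =
        (if q < n * K then real n * lam * (f (u + 1, q + 1) - f (u, q)) else 0)
        + \<nu> * (real n * min (real u / real n) M) * (g ((real u - 1) / n) (real q / n) - f (u, q))
        + \<mu> * real u * (g ((real u - 1) / n) ((real q - 1) / n) - f (u, q))
        + \<mu> * (real q - real u) * (g (real u / n) ((real q - 1) / n) - f (u, q))"
      unfolding scaled_drift_def full distrib_left[of "real n"] scale
      using n by (simp add: f_def add_divide_distrib diff_divide_distrib add.commute)
    also have "\<dots> = (\<Sum>z\<in>?S. ?r (u, q) z * (f z - f (u, q)))"
      unfolding power preds ev_generator_apply[OF uq nM] by (simp add: f_def)
    finally show ?thesis .
  qed
  have "measure_pmf.expectation p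
      (\<lambda>(u, q). scaled_drift lam \<mu> \<nu> K M n g (real u / n) (real q / n))
    = measure_pmf.expectation p (\<lambda>x. \<Sum>z\<in>?S. ?r x z * (f z - f x))"
    using supp by (intro integral_cong_AE) (auto simp: AE_measure_pmf_iff drift)
  also have "\<dots> = 0"
    by (rule ctmc_stationary_expectation_generator_eq_0[OF finite_ev_states stat])
  finally show ?thesis .
qed

section \<open>Concentration at the fluid equilibrium\<close>

text \<open>
  The term \<open>(y - b) * (a - \<mu> * b)\<close> of the drift, with \<open>a\<close> the current rate of admission, is never
  positive. For \<open>lam \<le> \<mu> * K\<close> we have \<open>\<mu> * b = lam\<close>, and \<open>a\<close> differs from \<open>lam\<close> only when \<open>y = K \<ge> b\<close>. For
  \<open>lam > \<mu> * K\<close> we have \<open>b = K \<ge> y\<close>, and \<open>a < \<mu> * b\<close> only when \<open>y = b\<close>. So blocking never works against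
  the pull \<open>- \<mu> * (y - b)\<^sup>2\<close>.
\<close>

lemma scaled_drift_occupancy_le:
  fixes lam \<mu> \<nu> K M N x y :: real
  defines "b \<equiv> min K (lam / \<mu>)"
  assumes pos: "0 < lam" "0 < \<mu>" "0 < N" and y: "0 \<le> y" "y \<le> K"
  shows "scaled_drift lam \<mu> \<nu> K M N (\<lambda>x y. (y - b)\<^sup>2 / 2) x y
    \<le> - \<mu> * (y - b)\<^sup>2 + (lam + \<mu> * K) / (2 * N)"
proof -
  define a where "a = (if y < K then lam else 0)"
  have a: "a \<le> lam"
    using pos by (simp add: a_def)
  have eq: "scaled_drift lam \<mu> \<nu> K M N (\<lambda>x y. (y - b)\<^sup>2 / 2) x y
      = (y - b) * (a - \<mu> * b) - \<mu> * (y - b)\<^sup>2 + (a + \<mu> * y) / (2 * N)"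
    using pos by (simp add: scaled_drift_def a_def field_simps power2_eq_square)
  have "(y - b) * (a - \<mu> * b) \<le> 0"
  proof (cases "lam \<le> \<mu> * K")
    case True
    then have "b = lam / \<mu>"
      using pos by (simp add: b_def field_simps)
    then show ?thesis
      using pos y True by (auto simp: a_def field_simps mult_le_0_iff)
  next
    case False
    then have "b = K"
      using pos by (simp add: b_def field_simps)
    then show ?thesis
      using pos y False by (auto simp: a_def mult_le_0_iff)
  qed
  moreover have "(a + \<mu> * y) / (2 * N) \<le> (lam + \<mu> * K) / (2 * N)"
    using a pos y by (intro divide_right_mono add_mono mult_left_mono) auto
  ultimately show ?thesis
    unfolding eq by linarith
qed

text \<open>
  In the drift of \<open>x * (y - b) - s * y - (x - s)\<^sup>2 / 2\<close> the admission rate, which is not close to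
  \<open>\<mu> * b\<close> pointwise, occurs only with a factor \<open>y - b\<close> or \<open>1 / N\<close>. The three parts of the function
  contribute \<open>x * a\<close>, \<open>- s * a\<close> and \<open>- (x - s) * a\<close>, and these cancel. The equilibrium equation
  turns the rest into \<open>(x - s)\<close> times the increment of \<open>\<mu> * x + \<nu> * min x M\<close> from \<open>s\<close> to \<open>x\<close>.
\<close>

lemma scaled_drift_uncharged_ge:
  fixes lam \<mu> \<nu> K M N x y s b :: real
  assumes pos: "0 < lam" "0 < \<mu>" "0 < \<nu>" "0 < N" "0 \<le> M"
    and xy: "0 \<le> x" "x \<le> y" "y \<le> K" and s: "0 \<le> s"
    and equil: "\<mu> * s + \<nu> * min s M = \<mu> * b"
  shows "\<mu> * (x - s)\<^sup>2 \<le>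
    scaled_drift lam \<mu> \<nu> K M N (\<lambda>x y. x * (y - b) - s * y - (x - s)\<^sup>2 / 2) x y
    + (lam + (\<nu> + 2 * \<mu>) * K + \<mu> * s) * \<bar>y - b\<bar> + \<nu> * K / (2 * N)"
proof -
  define a where "a = (if y < K then lam else 0)"
  define m where "m = min x M"
  have a: "0 \<le> a" "a \<le> lam"
    using pos by (simp_all add: a_def)
  have m: "0 \<le> m" "m \<le> K"
    using pos xy by (auto simp: m_def)
  have eq: "scaled_drift lam \<mu> \<nu> K M N (\<lambda>x y. x * (y - b) - s * y - (x - s)\<^sup>2 / 2) x y
      = (x - s) * (\<mu> * x + \<nu> * m - \<mu> * b) + (y - b) * (a - \<nu> * m - 2 * \<mu> * x + \<mu> * s)
        + (a + \<mu> * x - \<nu> * m) / (2 * N)"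
    using pos by (simp add: scaled_drift_def a_def m_def[symmetric] field_simps power2_eq_square)
  have "\<mu> * (x - s)\<^sup>2 \<le> (x - s) * (\<mu> * x + \<nu> * m - \<mu> * b)"
  proof -
    have "0 \<le> (x - s) * (m - min s M)"
      by (auto simp: m_def min_def zero_le_mult_iff)
    then have "0 \<le> \<nu> * ((x - s) * (m - min s M))"
      using pos by simp
    then show ?thesis
      unfolding equil[symmetric] by (simp add: algebra_simps power2_eq_square)
  qed
  moreover have "- ((lam + (\<nu> + 2 * \<mu>) * K + \<mu> * s) * \<bar>y - b\<bar>)
      \<le> (y - b) * (a - \<nu> * m - 2 * \<mu> * x + \<mu> * s)"
  proof -
    have "\<nu> * m \<le> \<nu> * K" "\<mu> * x \<le> \<mu> * K" "0 \<le> \<nu> * m" "0 \<le> \<mu> * x" "0 \<le> \<mu> * s" "0 \<le> \<nu> * K" "0 \<le> \<mu> * K"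
      using pos xy m s by auto
    then have "\<bar>a - \<nu> * m - 2 * \<mu> * x + \<mu> * s\<bar> \<le> lam + (\<nu> + 2 * \<mu>) * K + \<mu> * s"
      using a by (simp add: distrib_right)
    then have "\<bar>(y - b) * (a - \<nu> * m - 2 * \<mu> * x + \<mu> * s)\<bar>
        \<le> (lam + (\<nu> + 2 * \<mu>) * K + \<mu> * s) * \<bar>y - b\<bar>"
      unfolding abs_mult by (subst mult.commute) (intro mult_right_mono, simp_all)
    then show ?thesis
      by linarith
  qed
  moreover have "- (\<nu> * K / (2 * N)) \<le> (a + \<mu> * x - \<nu> * m) / (2 * N)"
  proof -
    have "- (\<nu> * K) \<le> a + \<mu> * x - \<nu> * m"
      using pos xy m a mult_left_mono[of m K \<nu>] mult_nonneg_nonneg[of \<mu> x] by linarith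
    from divide_right_mono[OF this, of "2 * N"] show ?thesis
      using pos by simp
  qed
  ultimately show ?thesis
    unfolding eq by linarith
qed

text \<open>
  The occupancy bound controls \<open>(y - b)\<^sup>2\<close>, whereas the drift inequality for \<open>x\<close> contains \<open>\<bar>y - b\<bar>\<close>.
  Passing from one to the other costs a square root, whence the rate \<open>1 / sqrt n\<close>.
\<close>

lemma uncharged_second_moment_bound:
  fixes lam \<mu> \<nu> M s :: real and K n :: nat
  defines "b \<equiv> min (real K) (lam / \<mu>)"
  assumes pos: "0 < lam" "0 < \<mu>" "0 < \<nu>" "0 \<le> M" and n: "n \<ge> 1" and s: "0 \<le> s"
    and equil: "\<mu> * s + \<nu> * min s M = \<mu> * b"
    and stat: "ctmc_stationary (ev_states (n * K))
      (ev_rate (real n * lam) \<mu> \<nu> (n * K) (real n * M)) p"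
  shows "measure_pmf.expectation p (\<lambda>(u, q). (real u / n - s)\<^sup>2) \<le>
    ((lam + (\<nu> + 2 * \<mu>) * K + \<mu> * s) * ((lam + \<mu> * K) / (4 * \<mu>) + 1 / 2) / sqrt n
      + \<nu> * K / (2 * real n)) / \<mu>"
proof -
  let ?E = "measure_pmf.expectation p"
  define D where "D = lam + (\<nu> + 2 * \<mu>) * K + \<mu> * s"
  define x :: "nat \<times> nat \<Rightarrow> real" where "x = (\<lambda>z. real (fst z) / n)"
  define y :: "nat \<times> nat \<Rightarrow> real" where "y = (\<lambda>z. real (snd z) / n)"
  define G where "G = (\<lambda>g z. scaled_drift lam \<mu> \<nu> K M n g (x z) (y z))"
  have supp: "set_pmf p \<subseteq> ev_states (n * K)"
    using stat by (simp add: ctmc_stationary_def)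
  then have int: "integrable p f" for f :: "nat \<times> nat \<Rightarrow> real"
    by (intro integrable_measure_pmf_finite finite_subset[OF _ finite_ev_states])
  have mono: "?E f \<le> ?E g" if "\<And>z. 0 \<le> x z \<Longrightarrow> x z \<le> y z \<Longrightarrow> y z \<le> K \<Longrightarrow> f z \<le> g z"
    for f g :: "nat \<times> nat \<Rightarrow> real"
  proof (rule integral_mono_AE[OF int int])
    note that' = that
    have "f z \<le> g z" if z: "z \<in> set_pmf p" for z
    proof (rule that')
      have "fst z \<le> snd z" "real (snd z) \<le> real (n * K)"
        using supp z by (auto simp: ev_states_def simp del: of_nat_mult)
      then show "0 \<le> x z" "x z \<le> y z" "y z \<le> K"
        using n by (simp_all add: x_def y_def divide_right_mono divide_le_eq mult.commute)
    qed
    then show "AE z in p. f z \<le> g z"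
      by (simp add: AE_measure_pmf_iff)
  qed
  have E0: "?E (G g) = 0" for g
    using expectation_scaled_drift_eq_0[OF n _ stat, of g] pos
    by (simp add: G_def x_def y_def case_prod_unfold)
  have N: "0 < real n"
    using n by simp
  have occ: "\<mu> * ?E (\<lambda>z. (y z - b)\<^sup>2) \<le> (lam + \<mu> * K) / (2 * real n)"
  proof -
    have "?E (G (\<lambda>x y. (y - b)\<^sup>2 / 2))
        \<le> ?E (\<lambda>z. - \<mu> * (y z - b)\<^sup>2 + (lam + \<mu> * K) / (2 * real n))"
    proof (rule mono)
      fix z assume z: "0 \<le> x z" "x z \<le> y z" "y z \<le> real K"
      then have "0 \<le> y z"
        by linarith
      from scaled_drift_occupancy_le[OF pos(1,2) N this z(3)]
      show "G (\<lambda>x y. (y - b)\<^sup>2 / 2) z \<le> - \<mu> * (y z - b)\<^sup>2 + (lam + \<mu> * K) / (2 * real n)"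
        unfolding G_def b_def by simp
    qed
    then show ?thesis
      by (simp add: E0 int)
  qed
  have D: "0 \<le> D"
    using pos s by (simp add: D_def)
  have "\<mu> * ?E (\<lambda>z. (x z - s)\<^sup>2)
      \<le> ?E (\<lambda>z. G (\<lambda>x y. x * (y - b) - s * y - (x - s)\<^sup>2 / 2) z
          + D * (sqrt n * (y z - b)\<^sup>2 / 2 + 1 / (2 * sqrt n)) + \<nu> * K / (2 * real n))"
  proof -
    \<comment> \<open>The weight \<open>sqrt n\<close> balances \<open>d\<^sup>2\<close>, whose expectation is of order \<open>1 / n\<close>, against the constant.\<close>
    have amgm: "\<bar>d\<bar> \<le> sqrt n * d\<^sup>2 / 2 + 1 / (2 * sqrt n)" for d :: real
    proof -
      have "0 \<le> (sqrt n * \<bar>d\<bar> - 1)\<^sup>2 / (2 * sqrt n)"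
        by simp
      also have "\<dots> = sqrt n * d\<^sup>2 / 2 + 1 / (2 * sqrt n) - \<bar>d\<bar>"
        using N by (simp add: power2_eq_square field_simps)
      finally show ?thesis
        by simp
    qed
    have "?E (\<lambda>z. \<mu> * (x z - s)\<^sup>2)
      \<le> ?E (\<lambda>z. G (\<lambda>x y. x * (y - b) - s * y - (x - s)\<^sup>2 / 2) z
          + D * (sqrt n * (y z - b)\<^sup>2 / 2 + 1 / (2 * sqrt n)) + \<nu> * K / (2 * real n))"
    proof (rule mono)
      fix z assume z: "0 \<le> x z" "x z \<le> y z" "y z \<le> real K"
      show "\<mu> * (x z - s)\<^sup>2 \<le> G (\<lambda>x y. x * (y - b) - s * y - (x - s)\<^sup>2 / 2) z
          + D * (sqrt n * (y z - b)\<^sup>2 / 2 + 1 / (2 * sqrt n)) + \<nu> * K / (2 * real n)"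
        using scaled_drift_uncharged_ge[OF pos(1-3) N pos(4) z s equil]
          mult_left_mono[OF amgm D, of "y z - b"]
        unfolding G_def D_def by linarith
    qed
    then show ?thesis
      by simp
  qed
  also have "\<dots> = D * (sqrt n * ?E (\<lambda>z. (y z - b)\<^sup>2) / 2 + 1 / (2 * sqrt n)) + \<nu> * K / (2 * real n)"
    by (simp add: E0 int)
  also have "\<dots> \<le> D * (sqrt n * ((lam + \<mu> * K) / (2 * real n) / \<mu>) / 2 + 1 / (2 * sqrt n))
      + \<nu> * K / (2 * real n)"
  proof -
    have "?E (\<lambda>z. (y z - b)\<^sup>2) \<le> (lam + \<mu> * K) / (2 * real n) / \<mu>"
      using occ pos(2) by (simp only: pos_le_divide_eq mult.commute)
    then show ?thesis
      using D by (intro add_mono mult_left_mono divide_right_mono order_refl) simp_all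
  qed
  also have "sqrt n * ((lam + \<mu> * K) / (2 * real n) / \<mu>) / 2 + 1 / (2 * sqrt n)
      = ((lam + \<mu> * K) / (4 * \<mu>) + 1 / 2) / sqrt n"
  proof -
    define w where "w = sqrt n"
    have "real n = w * w" "0 < w"
      using N by (simp_all add: w_def)
    then show ?thesis
      using pos(2) unfolding w_def[symmetric] by (simp add: divide_simps)
  qed
  finally have "?E (\<lambda>z. (x z - s)\<^sup>2)
      \<le> (D * (((lam + \<mu> * K) / (4 * \<mu>) + 1 / 2) / sqrt n) + \<nu> * K / (2 * real n)) / \<mu>"
    using pos by (simp add: pos_le_divide_eq mult.commute)
  then show ?thesis
    by (simp add: x_def D_def case_prod_unfold)
qed

section \<open>The fixed-point equation\<close>

lemma (in prob_space) expectation_min_exponential_scaled: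
  assumes pos: "0 < \<mu>" "0 < \<nu>" "0 < c"
    and X: "distributed M lborel X (exponential_density \<mu>)"
    and Y: "distributed M lborel Y (exponential_density \<nu>)"
    and ind: "indep_var borel X borel Y"
  shows "expectation (\<lambda>\<omega>. min (X \<omega>) (Y \<omega> * c)) = 1 / (\<mu> + \<nu> / c)"
proof -
  have "distributed M lborel (\<lambda>\<omega>. Y \<omega> * c) (exponential_density (\<nu> / c))"
    using Y pos
    by (auto simp: exponential_distributed_iff le_divide_eq[symmetric] pos_le_divide_eq[symmetric])
  moreover have "indep_var borel X borel (\<lambda>\<omega>. Y \<omega> * c)"
    using indep_var_compose[OF ind, of id borel "\<lambda>y. y * c" borel] by (simp add: comp_def)
  ultimately have "distributed M lborel (\<lambda>\<omega>. min (X \<omega>) (Y \<omega> * c)) (exponential_density (\<mu> + \<nu> / c))"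
    using pos X by (intro exponential_distributed_min) auto
  with pos show ?thesis
    by (intro exponential_distributed_expectation) (auto intro: add_pos_pos)
qed

text \<open>
  The map \<open>u \<mapsto> \<mu> * u + \<nu> * min u M\<close> is continuous and strictly increasing, vanishes at \<open>0\<close>, and
  is at least \<open>L\<close> at \<open>L / \<mu>\<close>.
\<close>

lemma fluid_equilibrium_unique:
  fixes \<mu> \<nu> M L :: real
  assumes "0 < \<mu>" "0 < \<nu>" "0 < M" "0 < L"
  shows "\<exists>s. 0 < s \<and> (\<forall>u. \<mu> * u + \<nu> * min u M = L \<longleftrightarrow> u = s)"
proof -
  let ?b = "\<lambda>u. \<mu> * u + \<nu> * min u M"
  have "\<exists>s\<ge>0. s \<le> L / \<mu> \<and> ?b s = L"
    using assms by (intro IVT') (auto intro!: continuous_intros)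
  then obtain s where s: "0 \<le> s" "?b s = L"
    by blast
  have "s \<noteq> 0"
    using s(2) assms by auto
  then have "0 < s"
    using s(1) by simp
  have uniq: "u = s" if "?b u = L" for u
  proof -
    have mono: "?b v < ?b w" if "v < w" for v w
      using that assms by (intro add_less_le_mono mult_left_mono) auto
    show ?thesis
      using mono[of u s] mono[of s u] that s by linarith
  qed
  show ?thesis
    using \<open>0 < s\<close> s(2) uniq by blast
qed

section \<open>Convergence to a constant\<close>

text \<open>
  The only point where the limiting distribution function is not continuous is \<open>c\<close>. At distance
  \<open>2 * e\<close> from \<open>c\<close> the distribution functions differ by at most the probability that \<open>X n\<close> is further than
  \<open>e\<close> from \<open>c\<close>.
\<close>

lemma weak_conv_m_return_if_tendsto_in_prob:
  fixes X :: "nat \<Rightarrow> 'a \<Rightarrow> real"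
  assumes conv: "\<And>\<epsilon>. 0 < \<epsilon> \<Longrightarrow> (\<lambda>n. measure_pmf.prob (p n) {z. \<epsilon> < \<bar>X n z - c\<bar>}) \<longlonglongrightarrow> 0"
  shows "weak_conv_m (\<lambda>n. distr (measure_pmf (p n)) borel (X n)) (return borel c)"
  unfolding weak_conv_m_def weak_conv_def
proof (intro allI impI)
  fix t assume cont: "isCont (cdf (return borel c)) t"
  have cdf_c: "cdf (return borel c) v = of_bool (c \<le> v)" for v
    by (simp add: cdf_def measure_return)
  have cdf_X: "cdf (distr (measure_pmf (p n)) borel (X n)) t = measure_pmf.prob (p n) {z. X n z \<le> t}" for n
    by (simp add: cdf_def measure_distr vimage_def)
  have "t \<noteq> c"
  proof
    assume "t = c"
    have "(cdf (return borel c) \<longlongrightarrow> 1) (at_left c)"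
      using cont \<open>t = c\<close> cdf_c[of c] by (auto simp: isCont_def intro: tendsto_mono[OF at_le])
    moreover have "(cdf (return borel c) \<longlongrightarrow> 0) (at_left c)"
      by (rule tendsto_eventually, rule eventually_at_leftI[of "c - 1"]) (auto simp: cdf_c)
    ultimately show False
      using tendsto_unique trivial_limit_at_left_real by fastforce
  qed
  define e where "e = \<bar>t - c\<bar> / 2"
  have e: "0 < e"
    using \<open>t \<noteq> c\<close> by (simp add: e_def)
  have "\<bar>measure_pmf.prob (p n) {z. X n z \<le> t} - of_bool (c \<le> t)\<bar>
      \<le> measure_pmf.prob (p n) {z. e < \<bar>X n z - c\<bar>}" for n
  proof (cases "c \<le> t")
    case True
    have "1 - measure_pmf.prob (p n) {z. X n z \<le> t} = measure_pmf.prob (p n) (- {z. X n z \<le> t})"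
      by (simp add: measure_pmf.prob_compl[symmetric] Compl_eq_Diff_UNIV)
    also have "\<dots> \<le> measure_pmf.prob (p n) {z. e < \<bar>X n z - c\<bar>}"
      using True e by (intro measure_pmf.finite_measure_mono) (auto simp: e_def)
    finally show ?thesis
      using True by simp
  next
    case False
    then have "measure_pmf.prob (p n) {z. X n z \<le> t} \<le> measure_pmf.prob (p n) {z. e < \<bar>X n z - c\<bar>}"
      by (intro measure_pmf.finite_measure_mono) (auto simp: e_def)
    then show ?thesis
      using False by simp
  qed
  then have "(\<lambda>n. measure_pmf.prob (p n) {z. X n z \<le> t} - of_bool (c \<le> t)) \<longlonglongrightarrow> 0"
    by (intro Lim_null_comparison[OF always_eventually conv[OF e]]) auto
  then show "(\<lambda>n. cdf (distr (measure_pmf (p n)) borel (X n)) t) \<longlonglongrightarrow> cdf (return borel c) t"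
    unfolding cdf_X cdf_c by (rule LIM_zero_cancel)
qed

theorem proposition3p2:
  fixes lam \<mu> \<nu> M :: real and K :: nat
    and p :: "nat \<Rightarrow> (nat \<times> nat) pmf"
    and P :: "'w measure" and E\<mu> E\<nu> :: "'w \<Rightarrow> real"
  assumes "lam > 0" "\<mu> > 0" "\<nu> > 0" "K > 0" "0 < M" "M \<le> real K"
    and "\<And>n. n \<ge> 1 \<Longrightarrow>
      ctmc_stationary (ev_states (n * K))
        (ev_rate (real n * lam) \<mu> \<nu> (n * K) (real n * M)) (p n)"
    and "prob_space P"
    and "distributed P lborel E\<mu> (exponential_density \<mu>)"
    and "distributed P lborel E\<nu> (exponential_density \<nu>)"
    and "prob_space.indep_var P borel E\<mu> borel E\<nu>"
  shows "\<exists>u\<^sub>s. (\<forall>u. (0 < u \<and>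
        u = min lam (\<mu> * real K) *
          prob_space.expectation P (\<lambda>\<omega>. min (E\<mu> \<omega>) (E\<nu> \<omega> * max 1 (u / M)))) \<longleftrightarrow> u = u\<^sub>s) \<and>
      weak_conv_m (\<lambda>n. distr (measure_pmf (p n)) borel (\<lambda>(u, q). real u / real n))
        (return borel u\<^sub>s) \<and>
      (\<forall>\<epsilon>>0. (\<lambda>n. measure_pmf.prob (p n) {(u, q). \<bar>real u / real n - u\<^sub>s\<bar> > \<epsilon>})
        \<longlonglongrightarrow> 0)"
proof -
  define L where "L = min lam (\<mu> * real K)"
  define b where "b = min (real K) (lam / \<mu>)"
  have L: "0 < L" and Lb: "L = \<mu> * b"
    using assms(1,2,4) by (auto simp: L_def b_def min_def field_simps)
  obtain s where s: "0 < s" and equil: "\<And>u. \<mu> * u + \<nu> * min u M = L \<longleftrightarrow> u = s"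
    using fluid_equilibrium_unique[OF assms(2,3,5) L] by blast
  have fixpoint: "(0 < u \<and> u = L * prob_space.expectation P
      (\<lambda>\<omega>. min (E\<mu> \<omega>) (E\<nu> \<omega> * max 1 (u / M)))) \<longleftrightarrow> u = s" for u
  proof (cases "0 < u")
    case True
    define c where "c = max 1 (u / M)"
    have c: "0 < c"
      by (simp add: c_def)
    have "u / c = min u M"
      using True assms(5) by (auto simp: c_def max_def min_def field_simps)
    moreover have "0 < \<mu> + \<nu> / c"
      using assms c by (intro add_pos_pos) auto
    ultimately have "u = L * (1 / (\<mu> + \<nu> / c)) \<longleftrightarrow> \<mu> * u + \<nu> * min u M = L"
      by (simp add: eq_divide_eq distrib_left mult.commute flip: \<open>u / c = min u M\<close>)
    then show ?thesis
      using True equil[of u] assms(2,3,8-11) c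
      by (simp add: prob_space.expectation_min_exponential_scaled flip: c_def)
  qed (use s in auto)
  define B where "B = (\<lambda>n. ((lam + (\<nu> + 2 * \<mu>) * K + \<mu> * s) * ((lam + \<mu> * K) / (4 * \<mu>) + 1 / 2)
      / sqrt (real n) + \<nu> * K / (2 * real n)) / \<mu>)"
  have B: "B \<longlonglongrightarrow> 0"
  proof -
    have "(\<lambda>n. 1 / sqrt (real n)) \<longlonglongrightarrow> 0" "(\<lambda>n. 1 / real n) \<longlonglongrightarrow> 0"
      by real_asymp+
    then have "(\<lambda>n. (A * (1 / sqrt (real n)) + C * (1 / real n)) / \<mu>) \<longlonglongrightarrow> (A * 0 + C * 0) / \<mu>" for A C
      using assms(2) by (intro tendsto_intros) auto
    from this[of "(lam + (\<nu> + 2 * \<mu>) * K + \<mu> * s) * ((lam + \<mu> * K) / (4 * \<mu>) + 1 / 2)" "\<nu> * K / 2"]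
    show ?thesis
      by (simp add: B_def)
  qed
  have conv: "(\<lambda>n. measure_pmf.prob (p n) {(u, q). \<bar>real u / real n - s\<bar> > \<epsilon>}) \<longlonglongrightarrow> 0"
    if \<epsilon>: "0 < \<epsilon>" for \<epsilon>
  proof (rule tendsto_sandwich[OF _ _ tendsto_const])
    show "(\<lambda>n. B n / \<epsilon>\<^sup>2) \<longlonglongrightarrow> 0"
      using tendsto_divide[OF B tendsto_const, of "\<epsilon>\<^sup>2"] \<epsilon> by simp
    show "\<forall>\<^sub>F n in sequentially.
        measure_pmf.prob (p n) {(u, q). \<bar>real u / real n - s\<bar> > \<epsilon>} \<le> B n / \<epsilon>\<^sup>2"
    proof (rule eventually_sequentiallyI)
      fix n :: nat assume n: "1 \<le> n"
      define X :: "nat \<times> nat \<Rightarrow> real" where "X = (\<lambda>z. real (fst z) / n - s)"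
      have fin: "finite (set_pmf (p n))"
        using assms(7)[OF n] finite_ev_states by (auto simp: ctmc_stationary_def intro: finite_subset)
      have "measure_pmf.prob (p n) {(u, q). \<bar>real u / real n - s\<bar> > \<epsilon>}
          \<le> measure_pmf.prob (p n) {z \<in> space (p n). \<epsilon> \<le> \<bar>X z\<bar>}"
        by (intro measure_pmf.finite_measure_mono) (auto simp: X_def)
      also have "\<dots> \<le> measure_pmf.expectation (p n) (\<lambda>z. (X z)\<^sup>2) / \<epsilon>\<^sup>2"
        by (rule measure_pmf.second_moment_method[OF _ integrable_measure_pmf_finite[OF fin] \<epsilon>]) simp
      also have "measure_pmf.expectation (p n) (\<lambda>z. (X z)\<^sup>2) \<le> B n"
      proof -
        have "\<mu> * s + \<nu> * min s M = \<mu> * min (real K) (lam / \<mu>)"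
          using equil[of s] Lb by (simp add: b_def)
        from uncharged_second_moment_bound[OF assms(1-3) less_imp_le[OF assms(5)] n
            less_imp_le[OF s] this assms(7)[OF n]]
        show ?thesis
          by (simp only: B_def X_def case_prod_unfold)
      qed
      finally show "measure_pmf.prob (p n) {(u, q). \<bar>real u / real n - s\<bar> > \<epsilon>} \<le> B n / \<epsilon>\<^sup>2"
        by (simp add: divide_right_mono)
    qed
  qed simp
  have "weak_conv_m (\<lambda>n. distr (measure_pmf (p n)) borel (\<lambda>(u, q). real u / real n)) (return borel s)"
    using conv by (intro weak_conv_m_return_if_tendsto_in_prob) (simp add: case_prod_unfold)
  then show ?thesis
    using fixpoint conv unfolding L_def by (intro exI[of _ s]) blast
qed

end
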